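(* Let $X$ be a shift space on a finite alphabet $A$ with a shift-invariant probability measure $\mu$ and a (monoid) morphism $\varphi\colon A^*\to G$ onto a finite group $G$. For every group language $L=\varphi^{-1}(K)$, $K\subseteq G$, the pointwise density $\dot\delta_L(x)$ exists for $\mu$-almost every $x\in X$. Moreover, the density $\delta_\mu(L)$ exists and is given by $$\delta_\mu(L)=\int_X\dot\delta_L\,d\mu.$$
   Context: A shift space on a finite alphabet $A$ is a nonempty closed subset $X\subseteq A^{\mathbb Z}$ invariant under the shift map $S((x_n)_n)=(x_{n+1})_n$, such that every letter of $A$ occurs in some element of $X$. Write $x_{[i,j)}=x_i\cdots x_{j-1}$. The density of $L\subseteq A^*$ under $\mu$ is $\delta_\mu(L)=\lim_{n\to\infty}\frac1n\sum_{i=0}^{n-1}\mu(\{x\in X:x_{[0,i)}\in L\})$ whenever it exists. For $L=\varphi^{-1}(K)$, the pointwise density of $L$ along the orbit of $x\in X$ is $\dot\delta_L(x)=\lim_{n\to\infty}\frac1n\sum_{i=0}^{n-1}1_K(\varphi(x_{[0,i)}))$ whenever it exists, where $1_K$ is the indicator function of $K$. *)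

theory Defs
  imports "HOL-Probability.Probability" "HOL-Algebra.Group"
begin

text \<open>Elements of \<open>A\<^sup>\<int>\<close> are functions \<open>int \<Rightarrow> 'a\<close> with values in \<open>A\<close>; since the index set is all
  of \<open>int\<close>, the extensional product has no junk outside the index set.\<close>

definition full_shift :: "'a set \<Rightarrow> (int \<Rightarrow> 'a) topology" where
  "full_shift A = product_topology (\<lambda>_. discrete_topology A) UNIV"

definition shift :: "(int \<Rightarrow> 'a) \<Rightarrow> (int \<Rightarrow> 'a)" where
  "shift x = (\<lambda>n. x (n + 1))"

definition shift_space :: "'a set \<Rightarrow> (int \<Rightarrow> 'a) set \<Rightarrow> bool" where
  "shift_space A X \<longleftrightarrow> finite A \<and> X \<noteq> {} \<and> closedin (full_shift A) X \<and> shift ` X = X \<and>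
     (\<forall>a\<in>A. \<exists>x\<in>X. \<exists>n. x n = a)"

definition shift_borel :: "'a set \<Rightarrow> (int \<Rightarrow> 'a) set \<Rightarrow> (int \<Rightarrow> 'a) measure" where
  "shift_borel A X = sigma X {U. openin (subtopology (full_shift A) X) U}"

definition shift_invariant_prob :: "'a set \<Rightarrow> (int \<Rightarrow> 'a) set \<Rightarrow> (int \<Rightarrow> 'a) measure \<Rightarrow> bool" where
  "shift_invariant_prob A X \<mu> \<longleftrightarrow> prob_space \<mu> \<and> space \<mu> = X \<and> sets \<mu> = sets (shift_borel A X) \<and>
     (\<forall>B\<in>sets \<mu>. emeasure \<mu> (shift -` B \<inter> X) = emeasure \<mu> B)"

text \<open>The word \<open>x\<^sub>i \<dots> x\<^sub>j\<^sub>-\<^sub>1\<close>; the bound \<open>j\<close> is exclusive, whereas \<open>[i..j]\<close> on integers is inclusive.\<close>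

definition factor :: "(int \<Rightarrow> 'a) \<Rightarrow> int \<Rightarrow> int \<Rightarrow> 'a list" where
  "factor x i j = map x [i..j - 1]"

definition free_monoid :: "'a set \<Rightarrow> 'a list monoid" where
  "free_monoid A = \<lparr>carrier = lists A, mult = (@), one = []\<rparr>"

text \<open>The library's \<open>hom\<close> and \<open>epi\<close> only demand compatibility with multiplication, so
  preservation of the unit is added.\<close>

definition onto_monoid_morphism :: "'a set \<Rightarrow> ('g, 'm) monoid_scheme \<Rightarrow> ('a list \<Rightarrow> 'g) \<Rightarrow> bool" where
  "onto_monoid_morphism A G \<phi> \<longleftrightarrow> \<phi> \<in> epi (free_monoid A) G \<and> \<phi> [] = \<one>\<^bsub>G\<^esub>"

definition group_language :: "'a set \<Rightarrow> ('a list \<Rightarrow> 'g) \<Rightarrow> 'g set \<Rightarrow> 'a list set" where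
  "group_language A \<phi> K = \<phi> -` K \<inter> lists A"

text \<open>A density exists iff its sequence of averages is \<open>convergent\<close>; \<open>lim\<close> is
  meaningful only in that case.\<close>

definition density_averages :: "(int \<Rightarrow> 'a) measure \<Rightarrow> 'a list set \<Rightarrow> nat \<Rightarrow> real" where
  "density_averages \<mu> L n = (1 / real n) * (\<Sum>i<n. measure \<mu> {x \<in> space \<mu>. factor x 0 (int i) \<in> L})"

definition density_of :: "(int \<Rightarrow> 'a) measure \<Rightarrow> 'a list set \<Rightarrow> real" where
  "density_of \<mu> L = lim (density_averages \<mu> L)"

definition pointwise_averages :: "('a list \<Rightarrow> 'g) \<Rightarrow> 'g set \<Rightarrow> (int \<Rightarrow> 'a) \<Rightarrow> nat \<Rightarrow> real" where
  "pointwise_averages \<phi> K x n = (1 / real n) * (\<Sum>i<n. indicator K (\<phi> (factor x 0 (int i))))"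

definition pointwise_density :: "('a list \<Rightarrow> 'g) \<Rightarrow> 'g set \<Rightarrow> (int \<Rightarrow> 'a) \<Rightarrow> real" where
  "pointwise_density \<phi> K x = lim (pointwise_averages \<phi> K x)"

end

theory Submission
  imports Defs
begin

text \<open>
  The skew product \<open>(x, g) \<mapsto> (S x, g \<cdot> \<phi>(x\<^sub>0))\<close> on \<open>X \<times> G\<close> preserves the product of \<open>\<mu>\<close> with the
  counting measure, because right multiplication permutes \<open>G\<close>. Its \<open>i\<close>-th iterate maps \<open>(x, 1)\<close> to
  \<open>(S\<^sup>i x, \<phi>(x\<^sub>0 \<dots> x\<^sub>i\<^sub>-\<^sub>1))\<close>, so the pointwise averages of \<open>L\<close> at \<open>x\<close> are the Birkhoff averages of
  \<open>1\<^sub>K(g)\<close> at \<open>(x, 1)\<close>. They converge almost everywhere by Birkhoff's theorem, each fibre over \<open>G\<close>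
  having positive weight, and bounded convergence yields the formula for the density.

  Birkhoff's theorem is obtained by Garsia's method. With \<open>F\<^sub>N = max(0, S\<^sub>1 f, \<dots>, S\<^sub>N f)\<close> one has
  \<open>F\<^sub>N - F\<^sub>N \<circ> T \<le> f\<close> on \<open>{F\<^sub>N > 0}\<close>, so \<open>f\<close> has nonnegative integral there. Hence \<open>c \<mu>(E) \<le> \<integral>\<^sub>E f\<close> for
  every invariant set \<open>E\<close> on which the upper average of \<open>f\<close> exceeds \<open>c\<close>. Applied to \<open>f\<close> and \<open>- f\<close>, this
  shows that the upper and the lower average are almost everywhere finite and equal.
\<close>

subsection \<open>Birkhoff sums and averages\<close>

definition birkhoff_sum :: "('b \<Rightarrow> 'b) \<Rightarrow> ('b \<Rightarrow> real) \<Rightarrow> nat \<Rightarrow> 'b \<Rightarrow> real" where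
  "birkhoff_sum T f n x = (\<Sum>i<n. f ((T ^^ i) x))"

definition birkhoff_average :: "('b \<Rightarrow> 'b) \<Rightarrow> ('b \<Rightarrow> real) \<Rightarrow> nat \<Rightarrow> 'b \<Rightarrow> real" where
  "birkhoff_average T f n x = birkhoff_sum T f n x / real n"

definition upper_birkhoff_average :: "('b \<Rightarrow> 'b) \<Rightarrow> ('b \<Rightarrow> real) \<Rightarrow> 'b \<Rightarrow> ereal" where
  "upper_birkhoff_average T f x = limsup (\<lambda>n. ereal (birkhoff_average T f n x))"

definition lower_birkhoff_average :: "('b \<Rightarrow> 'b) \<Rightarrow> ('b \<Rightarrow> real) \<Rightarrow> 'b \<Rightarrow> ereal" where
  "lower_birkhoff_average T f x = liminf (\<lambda>n. ereal (birkhoff_average T f n x))"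

text \<open>The maximum of \<open>birkhoff_sum T f n x\<close> over \<open>n \<le> N\<close>; the recursive form makes Garsia's estimate
  immediate.\<close>

primrec max_birkhoff_sum :: "('b \<Rightarrow> 'b) \<Rightarrow> ('b \<Rightarrow> real) \<Rightarrow> nat \<Rightarrow> 'b \<Rightarrow> real" where
  "max_birkhoff_sum T f 0 x = 0"
| "max_birkhoff_sum T f (Suc N) x = max 0 (f x + max_birkhoff_sum T f N (T x))"

lemma birkhoff_sum_0 [simp]: "birkhoff_sum T f 0 x = 0"
  by (simp add: birkhoff_sum_def)

lemma birkhoff_sum_Suc: "birkhoff_sum T f (Suc n) x = f x + birkhoff_sum T f n (T x)"
  unfolding birkhoff_sum_def by (subst sum.lessThan_Suc_shift) (simp add: funpow_swap1)

lemma birkhoff_sum_uminus: "birkhoff_sum T (\<lambda>y. - f y) n x = - birkhoff_sum T f n x"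
  by (simp add: birkhoff_sum_def sum_negf)

lemma birkhoff_sum_diff_const: "birkhoff_sum T (\<lambda>y. f y - c) n x = birkhoff_sum T f n x - c * real n"
  by (simp add: birkhoff_sum_def sum_subtractf)

lemma max_birkhoff_sum_nonneg: "0 \<le> max_birkhoff_sum T f N x"
  by (cases N) auto

lemma max_birkhoff_sum_le_Suc: "max_birkhoff_sum T f N x \<le> max_birkhoff_sum T f (Suc N) x"
proof (induction N arbitrary: x)
  case (Suc N)
  from Suc[of "T x"] have "f x + max_birkhoff_sum T f N (T x) \<le> f x + max_birkhoff_sum T f (Suc N) (T x)"
    by simp
  then show ?case
    unfolding max_birkhoff_sum.simps(2)[of _ _ _ x] by (rule max.mono[OF order_refl])
qed simp

lemma birkhoff_sum_le_max_birkhoff_sum: "n \<le> N \<Longrightarrow> birkhoff_sum T f n x \<le> max_birkhoff_sum T f N x"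
proof (induction n arbitrary: N x)
  case 0
  then show ?case by (simp add: max_birkhoff_sum_nonneg)
next
  case (Suc n)
  then obtain N' where "N = Suc N'" "n \<le> N'" by (cases N) auto
  with Suc.IH[of N' "T x"] show ?case by (simp add: birkhoff_sum_Suc max.coboundedI2)
qed

lemma max_birkhoff_sum_diff_le:
  "max_birkhoff_sum T f N x - max_birkhoff_sum T f N (T x)
    \<le> indicator {y. 0 < max_birkhoff_sum T f N y} x * f x"
proof (cases "0 < max_birkhoff_sum T f N x")
  case True
  then obtain N' where N: "N = Suc N'" by (cases N) auto
  with True have "max_birkhoff_sum T f N x = f x + max_birkhoff_sum T f N' (T x)"
    by (simp add: max_def split: if_splits)
  also have "\<dots> \<le> f x + max_birkhoff_sum T f N (T x)"
    unfolding N by (intro add_left_mono max_birkhoff_sum_le_Suc)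
  finally show ?thesis using True by simp
next
  case False
  with max_birkhoff_sum_nonneg[of T f N "T x"] show ?thesis by simp
qed

lemma lower_birkhoff_average_conv_upper:
  "lower_birkhoff_average T f x = - upper_birkhoff_average T (\<lambda>y. - f y) x"
  by (simp add: lower_birkhoff_average_def upper_birkhoff_average_def birkhoff_average_def
      birkhoff_sum_uminus ereal_Limsup_uminus flip: uminus_ereal.simps)

lemma upper_birkhoff_average_T: "upper_birkhoff_average T f (T x) = upper_birkhoff_average T f x"
proof -
  let ?A = "birkhoff_average T f"
  have "\<forall>\<^sub>F n in sequentially. ereal (?A n (T x)) =
      ereal (- f x / real n) + ereal (real (Suc n) / real n) * ereal (?A (Suc n) x)"
    using eventually_gt_at_top[of 0]
    by eventually_elim (simp add: birkhoff_average_def birkhoff_sum_Suc del: of_nat_Suc flip: diff_divide_distrib)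
  then have "upper_birkhoff_average T f (T x) =
      limsup (\<lambda>n. ereal (- f x / real n) + ereal (real (Suc n) / real n) * ereal (?A (Suc n) x))"
    unfolding upper_birkhoff_average_def by (rule Limsup_eq)
  also have "\<dots> = 0 + limsup (\<lambda>n. ereal (real (Suc n) / real n) * ereal (?A (Suc n) x))"
  proof (rule ereal_limsup_lim_add)
    show "(\<lambda>n. ereal (- f x / real n)) \<longlonglongrightarrow> 0"
      unfolding zero_ereal_def by (intro tendsto_ereal lim_const_over_n)
  qed simp
  also have "\<dots> = 0 + 1 * limsup (\<lambda>n. ereal (?A (Suc n) x))"
  proof (subst ereal_limsup_lim_mult)
    show "(\<lambda>n. ereal (real (Suc n) / real n)) \<longlonglongrightarrow> 1"
      unfolding one_ereal_def by (intro tendsto_ereal LIMSEQ_Suc_n_over_n)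
  qed simp_all
  also have "\<dots> = upper_birkhoff_average T f x"
    using limsup_shift[of "\<lambda>n. ereal (?A n x)"] by (simp add: upper_birkhoff_average_def)
  finally show ?thesis .
qed

lemma lower_birkhoff_average_T: "lower_birkhoff_average T f (T x) = lower_birkhoff_average T f x"
  by (simp add: lower_birkhoff_average_conv_upper upper_birkhoff_average_T)

lemma upper_birkhoff_average_gtE:
  assumes "ereal c < upper_birkhoff_average T f x"
  obtains n where "c * real n < birkhoff_sum T f n x"
proof -
  have "\<exists>n>0. ereal c < ereal (birkhoff_average T f n x)"
  proof (rule ccontr)
    assume "\<not> ?thesis"
    with not_less have "ereal (birkhoff_average T f n x) \<le> ereal c" if "0 < n" for n
      using that by blast
    then have "\<forall>\<^sub>F n in sequentially. ereal (birkhoff_average T f n x) \<le> ereal c"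
      by (rule eventually_mono[OF eventually_gt_at_top])
    from Limsup_bounded[OF this] assms show False by (simp add: upper_birkhoff_average_def)
  qed
  then show thesis using that by (auto simp: birkhoff_average_def field_simps)
qed

lemma convergent_birkhoff_average:
  assumes "upper_birkhoff_average T f x \<le> lower_birkhoff_average T f x"
    and "upper_birkhoff_average T f x < \<infinity>" and "- \<infinity> < lower_birkhoff_average T f x"
  shows "convergent (\<lambda>n. birkhoff_average T f n x)"
proof -
  have "lower_birkhoff_average T f x \<le> upper_birkhoff_average T f x"
    by (simp add: lower_birkhoff_average_def upper_birkhoff_average_def Liminf_le_Limsup)
  with assms obtain l where "upper_birkhoff_average T f x = ereal l" "lower_birkhoff_average T f x = ereal l"
    by (cases "upper_birkhoff_average T f x") auto
  then have "(\<lambda>n. birkhoff_average T f n x) \<longlonglongrightarrow> l"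
    by (intro limsup_le_liminf_real) (simp_all add: lower_birkhoff_average_def upper_birkhoff_average_def)
  then show ?thesis by (auto simp: convergent_def)
qed

subsection \<open>The maximal ergodic inequality\<close>

locale measure_preserving =
  fixes M :: "'b measure" and T :: "'b \<Rightarrow> 'b"
  assumes T_measurable [measurable]: "T \<in> measurable M M"
    and distr_T: "distr M M T = M"
begin

lemma T_space: "x \<in> space M \<Longrightarrow> T x \<in> space M"
  by (rule measurable_space[OF T_measurable])

lemma integrable_comp_T:
  fixes f :: "'b \<Rightarrow> real"
  assumes "integrable M f"
  shows "integrable M (\<lambda>x. f (T x))"
  using assms by (intro integrable_distr[OF T_measurable]) (simp add: distr_T)

lemma integral_comp_T:
  fixes f :: "'b \<Rightarrow> real"
  assumes "f \<in> borel_measurable M"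
  shows "(\<integral>x. f (T x) \<partial>M) = (\<integral>x. f x \<partial>M)"
  using integral_distr[OF T_measurable assms] by (simp add: distr_T)

lemma measurable_birkhoff_average [measurable]:
  assumes [measurable]: "f \<in> borel_measurable M"
  shows "birkhoff_average T f n \<in> borel_measurable M"
  unfolding birkhoff_average_def[abs_def] birkhoff_sum_def by measurable

lemma measurable_upper_birkhoff_average [measurable]:
  assumes [measurable]: "f \<in> borel_measurable M"
  shows "upper_birkhoff_average T f \<in> borel_measurable M"
  unfolding upper_birkhoff_average_def[abs_def] by measurable

lemma measurable_lower_birkhoff_average [measurable]:
  assumes [measurable]: "f \<in> borel_measurable M"
  shows "lower_birkhoff_average T f \<in> borel_measurable M"
  unfolding lower_birkhoff_average_def[abs_def] by measurable

lemma integrable_max_birkhoff_sum: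
  assumes "integrable M f"
  shows "integrable M (max_birkhoff_sum T f N)"
proof (induction N)
  case 0
  then show ?case by (simp add: max_birkhoff_sum.simps(1)[abs_def])
next
  case (Suc N)
  have "integrable M (\<lambda>x. max 0 (f x + max_birkhoff_sum T f N (T x)))"
    by (intro integrable_max Bochner_Integration.integrable_add assms integrable_comp_T[OF Suc]) simp
  then show ?case by (simp add: max_birkhoff_sum.simps(2)[abs_def])
qed

lemma maximal_ergodic_inequality:
  assumes f: "integrable M f"
  shows "0 \<le> (LINT x:{x. 0 < max_birkhoff_sum T f N x}|M. f x)"
proof -
  let ?F = "max_birkhoff_sum T f N"
  have F: "integrable M ?F" by (rule integrable_max_birkhoff_sum[OF f])
  note [measurable] = borel_measurable_integrable[OF f] borel_measurable_integrable[OF F]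
  have "integrable M (\<lambda>x. indicator {x. 0 < ?F x} x * f x)"
    by (rule Bochner_Integration.integrable_bound[OF f]) (auto simp: indicator_def)
  then have "(\<integral>x. ?F x - ?F (T x) \<partial>M) \<le> (\<integral>x. indicator {x. 0 < ?F x} x * f x \<partial>M)"
    using F integrable_comp_T[OF F] by (intro integral_mono max_birkhoff_sum_diff_le) auto
  moreover have "(\<integral>x. ?F x - ?F (T x) \<partial>M) = 0"
    using F integrable_comp_T[OF F] by (simp add: integral_comp_T)
  ultimately show ?thesis by (simp add: set_lebesgue_integral_def)
qed

lemma birkhoff_sum_pos_imp_integral_nonneg:
  assumes f: "integrable M f"
    and pos: "\<And>x. x \<in> space M \<Longrightarrow> f x \<noteq> 0 \<Longrightarrow> \<exists>n. 0 < birkhoff_sum T f n x"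
  shows "0 \<le> (\<integral>x. f x \<partial>M)"
proof -
  let ?g = "\<lambda>N x. indicator {x. 0 < max_birkhoff_sum T f N x} x * f x"
  note [measurable] = borel_measurable_integrable[OF f]
    borel_measurable_integrable[OF integrable_max_birkhoff_sum[OF f]]
  have "(\<lambda>N. ?g N x) \<longlonglongrightarrow> f x" if x: "x \<in> space M" for x
  proof (cases "f x = 0")
    case False
    then obtain n where "0 < birkhoff_sum T f n x" using pos[OF x] by blast
    then have "?g N x = f x" if "n \<le> N" for N
      using birkhoff_sum_le_max_birkhoff_sum[OF that, of T f x] by simp
    then show ?thesis by (intro tendsto_eventually) (auto simp: eventually_sequentially)
  qed simp
  then have "(\<lambda>N. \<integral>x. ?g N x \<partial>M) \<longlonglongrightarrow> (\<integral>x. f x \<partial>M)"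
    by (intro integral_dominated_convergence[where w = "\<lambda>x. \<bar>f x\<bar>"])
      (use f in \<open>auto simp: indicator_def\<close>)
  then show ?thesis
    by (rule LIMSEQ_le_const)
      (use maximal_ergodic_inequality[OF f] in \<open>auto simp: set_lebesgue_integral_def\<close>)
qed

definition invariant_set :: "'b set \<Rightarrow> bool" where
  "invariant_set E \<longleftrightarrow> E \<in> sets M \<and> (\<forall>x\<in>space M. T x \<in> E \<longleftrightarrow> x \<in> E)"

lemma birkhoff_sum_indicator_invariant_set:
  assumes "invariant_set E" and "x \<in> space M"
  shows "birkhoff_sum T (\<lambda>y. indicator E y * f y) n x = indicator E x * birkhoff_sum T f n x"
  using assms(2)
proof (induction n arbitrary: x)
  case (Suc n)
  have "indicator E (T x) = (indicator E x :: real)"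
    using assms(1) Suc.prems by (simp add: invariant_set_def indicator_def)
  with Suc.IH[OF T_space[OF Suc.prems]] show ?case by (simp add: birkhoff_sum_Suc algebra_simps)
qed simp

end

subsection \<open>Birkhoff's pointwise ergodic theorem\<close>

locale finite_measure_preserving = finite_measure M + measure_preserving M T
  for M :: "'b measure" and T :: "'b \<Rightarrow> 'b"
begin

lemma upper_birkhoff_average_gt_imp_set_integral_ge:
  fixes c :: real
  assumes f: "integrable M f" and E: "invariant_set E"
    and gt: "\<And>x. x \<in> E \<Longrightarrow> c < upper_birkhoff_average T f x"
  shows "c * measure M E \<le> (LINT x:E|M. f x)"
proof -
  let ?g = "\<lambda>x. indicator E x * (f x - c)"
  have [measurable]: "E \<in> sets M" using E by (simp add: invariant_set_def)
  have int: "integrable M (\<lambda>x. indicator E x * f x)" "integrable M (\<lambda>x. indicator E x * c)"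
    using integrable_mult_indicator[of E M f] integrable_mult_indicator[of E M "\<lambda>_. c"] f by simp_all
  have "0 \<le> (\<integral>x. ?g x \<partial>M)"
  proof (rule birkhoff_sum_pos_imp_integral_nonneg)
    show "integrable M ?g" using int by (simp add: right_diff_distrib)
  next
    fix x assume x: "x \<in> space M" and "?g x \<noteq> 0"
    then have "x \<in> E" by (auto simp: indicator_def)
    from upper_birkhoff_average_gtE[OF gt[OF this]]
    obtain n where "c * real n < birkhoff_sum T f n x" .
    with \<open>x \<in> E\<close> have "0 < birkhoff_sum T ?g n x"
      by (simp add: birkhoff_sum_indicator_invariant_set[OF E x] birkhoff_sum_diff_const)
    then show "\<exists>n. 0 < birkhoff_sum T ?g n x" ..
  qed
  also have "(\<integral>x. ?g x \<partial>M) = (LINT x:E|M. f x) - c * measure M E"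
    using int by (simp add: right_diff_distrib set_lebesgue_integral_def)
  finally show ?thesis by simp
qed

lemma AE_upper_birkhoff_average_less_top:
  assumes f: "integrable M f"
  shows "AE x in M. upper_birkhoff_average T f x < \<infinity>"
proof -
  note [measurable] = borel_measurable_integrable[OF f]
  define E where "E = {x \<in> space M. upper_birkhoff_average T f x = \<infinity>}"
  have [measurable]: "E \<in> sets M" unfolding E_def by measurable
  then have E: "invariant_set E"
    by (auto simp: invariant_set_def E_def upper_birkhoff_average_T T_space)
  have bound: "c * measure M E \<le> (LINT x:E|M. f x)" for c
    by (rule upper_birkhoff_average_gt_imp_set_integral_ge[OF f E]) (simp add: E_def)
  have "measure M E = 0"
  proof (rule ccontr)
    assume "measure M E \<noteq> 0"
    with bound[of "((LINT x:E|M. f x) + 1) / measure M E"] show False by simp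
  qed
  then have "E \<in> null_sets M" by (simp add: null_sets_def emeasure_eq_measure)
  then show ?thesis by (rule AE_I') (auto simp: E_def)
qed

lemma AE_not_lower_less_and_less_upper_birkhoff_average:
  fixes a b :: real
  assumes f: "integrable M f" and "a < b"
  shows "AE x in M. \<not> (lower_birkhoff_average T f x < a \<and> b < upper_birkhoff_average T f x)"
proof -
  note [measurable] = borel_measurable_integrable[OF f]
  define E where "E = {x \<in> space M. lower_birkhoff_average T f x < a \<and> b < upper_birkhoff_average T f x}"
  have [measurable]: "E \<in> sets M" unfolding E_def by measurable
  then have E: "invariant_set E"
    by (auto simp: invariant_set_def E_def upper_birkhoff_average_T lower_birkhoff_average_T T_space)
  have "b * measure M E \<le> (LINT x:E|M. f x)"
    by (rule upper_birkhoff_average_gt_imp_set_integral_ge[OF f E]) (simp add: E_def)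
  moreover have "- a * measure M E \<le> (LINT x:E|M. - f x)"
  proof (rule upper_birkhoff_average_gt_imp_set_integral_ge[OF _ E])
    fix x assume "x \<in> E"
    then have "- upper_birkhoff_average T (\<lambda>y. - f y) x < ereal a"
      by (simp add: E_def lower_birkhoff_average_conv_upper)
    then show "ereal (- a) < upper_birkhoff_average T (\<lambda>y. - f y) x"
      by (simp add: ereal_uminus_less_reorder)
  qed (use f in simp)
  ultimately have "b * measure M E \<le> a * measure M E"
    by (simp add: set_lebesgue_integral_def)
  then have "measure M E = 0"
    using \<open>a < b\<close> measure_nonneg[of M E] by (simp add: mult_le_cancel_right)
  then have "E \<in> null_sets M" by (simp add: null_sets_def emeasure_eq_measure)
  then show ?thesis by (rule AE_I') (auto simp: E_def)
qed

lemma AE_upper_le_lower_birkhoff_average: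
  assumes "integrable M f"
  shows "AE x in M. upper_birkhoff_average T f x \<le> lower_birkhoff_average T f x"
proof -
  have "AE x in M. \<forall>a b :: rat. a < b \<longrightarrow>
      \<not> (lower_birkhoff_average T f x < real_of_rat a \<and> real_of_rat b < upper_birkhoff_average T f x)"
    unfolding AE_all_countable
    using AE_not_lower_less_and_less_upper_birkhoff_average[OF assms] by (simp add: of_rat_less)
  then show ?thesis
  proof eventually_elim
    case no_gap: (elim x)
    show ?case
    proof (rule ccontr)
      assume "\<not> upper_birkhoff_average T f x \<le> lower_birkhoff_average T f x"
      then obtain a where a: "lower_birkhoff_average T f x < real_of_rat a"
          "real_of_rat a < upper_birkhoff_average T f x"
        using ereal_dense3 by (auto simp: not_le)
      then obtain b where "ereal (real_of_rat a) < real_of_rat b"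
          "real_of_rat b < upper_birkhoff_average T f x"
        using ereal_dense3 by blast
      with a no_gap show False by (auto simp: of_rat_less)
    qed
  qed
qed

theorem AE_convergent_birkhoff_average:
  assumes f: "integrable M f"
  shows "AE x in M. convergent (\<lambda>n. birkhoff_average T f n x)"
proof -
  have "AE x in M. upper_birkhoff_average T (\<lambda>y. - f y) x < \<infinity>"
    using f by (intro AE_upper_birkhoff_average_less_top) simp
  then have "AE x in M. - \<infinity> < lower_birkhoff_average T f x"
    by eventually_elim (simp add: lower_birkhoff_average_conv_upper)
  with AE_upper_le_lower_birkhoff_average[OF f] AE_upper_birkhoff_average_less_top[OF f]
  show ?thesis
    by eventually_elim (rule convergent_birkhoff_average)
qed

end

subsection \<open>Skew products and group extensions\<close>

definition skew_product :: "('b \<Rightarrow> 'b) \<Rightarrow> ('b \<Rightarrow> 'c \<Rightarrow> 'c) \<Rightarrow> 'b \<times> 'c \<Rightarrow> 'b \<times> 'c" where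
  "skew_product T h = (\<lambda>(x, y). (T x, h x y))"

lemma (in measure_preserving) measure_preserving_skew_product:
  assumes "sigma_finite_measure N"
    and h [measurable]: "(\<lambda>(x, y). h x y) \<in> measurable (M \<Otimes>\<^sub>M N) N"
    and distr_h: "\<And>x. x \<in> space M \<Longrightarrow> distr N N (h x) = N"
  shows "measure_preserving (M \<Otimes>\<^sub>M N) (skew_product T h)"
proof
  interpret N: sigma_finite_measure N by fact
  let ?P = "M \<Otimes>\<^sub>M N" and ?R = "skew_product T h"
  show R [measurable]: "?R \<in> measurable ?P ?P"
    unfolding skew_product_def by measurable
  show "distr ?P ?P ?R = ?P"
  proof (rule measure_eqI)
    fix B assume "B \<in> sets (distr ?P ?P ?R)"
    then have B [measurable]: "B \<in> sets ?P" by simp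
    have fibre: "emeasure N (Pair x -` (?R -` B \<inter> space ?P)) = emeasure N (Pair (T x) -` B)"
      if x: "x \<in> space M" for x
    proof -
      have hx: "h x \<in> measurable N N" using measurable_Pair2[OF h x] by simp
      have "Pair x -` (?R -` B \<inter> space ?P) = h x -` (Pair (T x) -` B) \<inter> space N"
        using x by (auto simp: skew_product_def space_pair_measure)
      also have "emeasure N \<dots> = emeasure (distr N N (h x)) (Pair (T x) -` B)"
        by (rule emeasure_distr[OF hx sets_Pair1[OF B], symmetric])
      finally show ?thesis by (simp add: distr_h[OF x])
    qed
    have "emeasure (distr ?P ?P ?R) B = emeasure ?P (?R -` B \<inter> space ?P)"
      by (rule emeasure_distr[OF R B])
    also have "\<dots> = (\<integral>\<^sup>+x. emeasure N (Pair x -` (?R -` B \<inter> space ?P)) \<partial>M)"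
      by (rule N.emeasure_pair_measure_alt) measurable
    also have "\<dots> = (\<integral>\<^sup>+x. emeasure N (Pair (T x) -` B) \<partial>M)"
      by (rule nn_integral_cong[OF fibre])
    also have "\<dots> = (\<integral>\<^sup>+x. emeasure N (Pair x -` B) \<partial>(distr M M T))"
      by (rule nn_integral_distr[symmetric]) (use N.measurable_emeasure_Pair[OF B] in auto)
    also have "\<dots> = emeasure ?P B"
      by (simp add: distr_T N.emeasure_pair_measure_alt[OF B])
    finally show "emeasure (distr ?P ?P ?R) B = emeasure ?P B" .
  qed simp
qed

lemma (in group) distr_count_space_mult_right:
  assumes "h \<in> carrier G"
  shows "distr (count_space (carrier G)) (count_space (carrier G)) (\<lambda>g. g \<otimes> h) = count_space (carrier G)"
proof (rule distr_bij_count_space)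
  show "bij_betw (\<lambda>g. g \<otimes> h) (carrier G) (carrier G)"
    by (rule bij_betw_byWitness[where f' = "\<lambda>g. g \<otimes> inv h"]) (use assms in \<open>auto simp: m_assoc\<close>)
qed

lemma (in monoid) measurable_mult_count_space:
  assumes "countable (carrier G)"
    and "c \<in> measurable M (count_space (carrier G))" "d \<in> measurable M (count_space (carrier G))"
  shows "(\<lambda>x. c x \<otimes> d x) \<in> measurable M (count_space (carrier G))"
proof -
  let ?N = "count_space (carrier G)"
  have "(\<lambda>(g, h). g \<otimes> h) \<in> measurable (?N \<Otimes>\<^sub>M ?N) ?N"
    using assms(1) by (auto simp: pair_measure_countable)
  from measurable_compose[OF measurable_Pair[OF assms(2,3)] this] show ?thesis by simp
qed

primrec cocycle_product ::
  "('g, 'm) monoid_scheme \<Rightarrow> ('b \<Rightarrow> 'b) \<Rightarrow> ('b \<Rightarrow> 'g) \<Rightarrow> nat \<Rightarrow> 'b \<Rightarrow> 'g" where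
  "cocycle_product G T c 0 x = \<one>\<^bsub>G\<^esub>"
| "cocycle_product G T c (Suc n) x = cocycle_product G T c n x \<otimes>\<^bsub>G\<^esub> c ((T ^^ n) x)"

lemma funpow_skew_product_mult_right:
  "(skew_product T (\<lambda>x g. g \<otimes>\<^bsub>G\<^esub> c x) ^^ n) (x, \<one>\<^bsub>G\<^esub>) = ((T ^^ n) x, cocycle_product G T c n x)"
  by (induction n) (simp_all add: skew_product_def)

lemma (in measure_preserving) measurable_cocycle_product:
  fixes G :: "('g, 'm) monoid_scheme"
  assumes "monoid G" and "countable (carrier G)"
    and [measurable]: "c \<in> measurable M (count_space (carrier G))"
  shows "cocycle_product G T c n \<in> measurable M (count_space (carrier G))"
proof (induction n)
  case 0
  show ?case by (simp add: monoid.one_closed[OF assms(1)])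
next
  case (Suc n)
  have "(\<lambda>x. c ((T ^^ n) x)) \<in> measurable M (count_space (carrier G))" by measurable
  from monoid.measurable_mult_count_space[OF assms(1,2) Suc this] show ?case by simp
qed

lemma (in measure_preserving) measure_preserving_group_extension:
  fixes G :: "('g, 'm) monoid_scheme"
  assumes "group G" and "countable (carrier G)"
    and c: "c \<in> measurable M (count_space (carrier G))"
  shows "measure_preserving (M \<Otimes>\<^sub>M count_space (carrier G)) (skew_product T (\<lambda>x g. g \<otimes>\<^bsub>G\<^esub> c x))"
proof (rule measure_preserving_skew_product)
  interpret G: group G by fact
  let ?N = "count_space (carrier G)"
  show "sigma_finite_measure ?N"
    using assms(2) by (rule sigma_finite_measure_count_space_countable)
  show "(\<lambda>(x, g). g \<otimes>\<^bsub>G\<^esub> c x) \<in> measurable (M \<Otimes>\<^sub>M ?N) ?N"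
    using G.measurable_mult_count_space[OF assms(2) measurable_snd measurable_compose[OF measurable_fst c]]
    by (simp add: case_prod_beta')
  show "distr ?N ?N (\<lambda>g. g \<otimes>\<^bsub>G\<^esub> c x) = ?N" if "x \<in> space M" for x
    using measurable_space[OF c that] by (intro G.distr_count_space_mult_right) simp
qed

theorem (in finite_measure_preserving) AE_convergent_cocycle_product_average:
  fixes G :: "('g, 'm) monoid_scheme" and f :: "'g \<Rightarrow> real"
  assumes "group G" and fin: "finite (carrier G)"
    and c: "c \<in> measurable M (count_space (carrier G))"
  shows "AE x in M. convergent (\<lambda>n. (\<Sum>i<n. f (cocycle_product G T c i x)) / real n)"
proof -
  interpret G: group G by fact
  let ?N = "count_space (carrier G)"
  let ?R = "skew_product T (\<lambda>x g. g \<otimes>\<^bsub>G\<^esub> c x)" and ?f = "\<lambda>p. f (snd p)"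
  interpret N: finite_measure ?N by (rule finite_measure_count_space[OF fin])
  interpret P: pair_sigma_finite M ?N ..
  interpret R: finite_measure_preserving "M \<Otimes>\<^sub>M ?N" ?R
    by (intro finite_measure_preserving.intro finite_measure_pair_measure finite_measure_axioms
        N.finite_measure_axioms measure_preserving_group_extension assms countable_finite)
  have "integrable (M \<Otimes>\<^sub>M ?N) ?f"
  proof (rule R.integrable_const_bound)
    show "?f \<in> borel_measurable (M \<Otimes>\<^sub>M ?N)" by (rule measurable_compose[OF measurable_snd]) simp
    show "AE p in M \<Otimes>\<^sub>M ?N. norm (?f p) \<le> (\<Sum>g\<in>carrier G. \<bar>f g\<bar>)"
      by (intro AE_I2) (auto simp: space_pair_measure intro!: member_le_sum fin)
  qed
  from P.AE_pair[OF R.AE_convergent_birkhoff_average[OF this]]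
  have "AE x in M. \<forall>g\<in>carrier G. convergent (\<lambda>n. birkhoff_average ?R ?f n (x, g))"
    by (simp add: AE_count_space)
  then have "AE x in M. convergent (\<lambda>n. birkhoff_average ?R ?f n (x, \<one>\<^bsub>G\<^esub>))"
    by eventually_elim (rule bspec[OF _ G.one_closed])
  then show ?thesis
    by (simp add: birkhoff_average_def birkhoff_sum_def funpow_skew_product_mult_right)
qed

subsection \<open>Invariant measures on shift spaces\<close>

lemma funpow_shift: "(shift ^^ i) x n = x (n + int i)"
  by (induction i arbitrary: n) (auto simp: shift_def algebra_simps)

lemma factor_Suc: "factor x 0 (int (Suc n)) = factor x 0 (int n) @ [x (int n)]"
  by (simp add: factor_def upto_rec2)

locale invariant_shift_space =
  fixes A :: "'a set" and X :: "(int \<Rightarrow> 'a) set" and \<mu> :: "(int \<Rightarrow> 'a) measure"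
  assumes shift_space: "shift_space A X"
    and shift_invariant_prob: "shift_invariant_prob A X \<mu>"
begin

sublocale prob_space \<mu>
  using shift_invariant_prob by (simp add: shift_invariant_prob_def)

lemma space_eq: "space \<mu> = X"
  using shift_invariant_prob by (simp add: shift_invariant_prob_def)

lemma letter_in_alphabet: "x \<in> X \<Longrightarrow> x i \<in> A"
  using shift_space closedin_subset[of "full_shift A" X]
  by (auto simp: shift_space_def full_shift_def PiE_def Pi_def)

lemma factor_in_lists: "x \<in> X \<Longrightarrow> factor x i j \<in> lists A"
  by (auto simp: factor_def letter_in_alphabet)

lemma openin_imp_sets: "openin (subtopology (full_shift A) X) U \<Longrightarrow> U \<in> sets \<mu>"
  using shift_invariant_prob openin_imp_subset[of "full_shift A" X]
  by (auto simp: shift_invariant_prob_def shift_borel_def intro!: in_measure_of)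

lemma topspace_eq: "topspace (subtopology (full_shift A) X) = X"
  using shift_space by (auto simp: shift_space_def dest: closedin_subset)

lemma measurable_coordinate: "(\<lambda>x. x i) \<in> measurable \<mu> (count_space A)"
proof -
  have cont: "continuous_map (subtopology (full_shift A) X) (discrete_topology A) (\<lambda>x. x i)"
    unfolding full_shift_def
    by (intro continuous_map_from_subtopology continuous_map_product_projection) simp
  have "(\<lambda>x. x i) -` {a} \<inter> space \<mu> \<in> sets \<mu>" if "a \<in> A" for a
  proof -
    have "(\<lambda>x. x i) -` {a} \<inter> space \<mu> = {x \<in> topspace (subtopology (full_shift A) X). x i \<in> {a}}"
      by (auto simp: topspace_eq space_eq simp del: topspace_subtopology)
    with openin_continuous_map_preimage[OF cont, of "{a}"] that show ?thesis
      by (simp add: openin_imp_sets)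
  qed
  then show ?thesis
    using shift_space letter_in_alphabet
    by (subst measurable_count_space_eq2) (auto simp: shift_space_def space_eq)
qed

lemma measurable_shift: "shift \<in> measurable \<mu> \<mu>"
proof -
  let ?T = "subtopology (full_shift A) X"
  have shift_X: "shift x \<in> X" if "x \<in> X" for x
    using shift_space that by (auto simp: shift_space_def)
  have "continuous_map (full_shift A) (full_shift A) shift"
    unfolding full_shift_def continuous_map_componentwise_UNIV shift_def
    by (intro allI continuous_map_product_projection) simp
  then have cont: "continuous_map ?T ?T shift"
    using shift_X by (intro continuous_map_into_subtopology continuous_map_from_subtopology) auto
  have "shift -` U \<inter> X \<in> sets \<mu>" if "openin ?T U" for U
  proof -
    have "shift -` U \<inter> X = {x \<in> topspace ?T. shift x \<in> U}" unfolding topspace_eq by blast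
    with openin_continuous_map_preimage[OF cont that] show ?thesis by (simp add: openin_imp_sets)
  qed
  then have "shift \<in> measurable \<mu> (shift_borel A X)"
    unfolding shift_borel_def using shift_X
    by (intro measurable_measure_of) (auto simp: space_eq dest: openin_imp_subset)
  moreover have "sets \<mu> = sets (shift_borel A X)"
    using shift_invariant_prob by (simp add: shift_invariant_prob_def)
  ultimately show ?thesis by (simp cong: measurable_cong_sets)
qed

sublocale finite_measure_preserving \<mu> shift
proof
  show "distr \<mu> \<mu> shift = \<mu>"
    using shift_invariant_prob measurable_shift
    by (intro measure_eqI) (auto simp: shift_invariant_prob_def emeasure_distr)
qed (rule measurable_shift)

end

subsection \<open>Densities of group languages\<close>

lemma (in finite_measure) bounded_convergence_lim:
  fixes u :: "nat \<Rightarrow> 'a \<Rightarrow> real"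
  assumes [measurable]: "\<And>n. u n \<in> borel_measurable M"
    and bound: "\<And>n x. x \<in> space M \<Longrightarrow> \<bar>u n x\<bar> \<le> C"
    and "AE x in M. convergent (\<lambda>n. u n x)"
  shows "integrable M (\<lambda>x. lim (\<lambda>n. u n x))"
    and "(\<lambda>n. \<integral>x. u n x \<partial>M) \<longlonglongrightarrow> (\<integral>x. lim (\<lambda>n. u n x) \<partial>M)"
proof -
  have lim: "AE x in M. (\<lambda>n. u n x) \<longlonglongrightarrow> lim (\<lambda>n. u n x)"
    using assms(3) by (simp add: convergent_LIMSEQ_iff)
  show "integrable M (\<lambda>x. lim (\<lambda>n. u n x))"
    by (rule integrable_dominated_convergence[OF _ _ integrable_const[of C] lim]) (simp_all add: bound)
  show "(\<lambda>n. \<integral>x. u n x \<partial>M) \<longlonglongrightarrow> (\<integral>x. lim (\<lambda>n. u n x) \<partial>M)"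
    by (rule integral_dominated_convergence[OF _ _ integrable_const[of C] lim]) (simp_all add: bound)
qed

locale shift_group_morphism = invariant_shift_space A X \<mu> + group G
  for A :: "'a set" and X :: "(int \<Rightarrow> 'a) set" and \<mu> :: "(int \<Rightarrow> 'a) measure"
    and G :: "('g, 'm) monoid_scheme" (structure) +
  fixes \<phi> :: "'a list \<Rightarrow> 'g"
  assumes finite_carrier: "finite (carrier G)"
    and \<phi>_hom: "\<phi> \<in> hom (free_monoid A) G"
    and \<phi>_Nil: "\<phi> [] = \<one>"
begin

lemma \<phi>_closed: "w \<in> lists A \<Longrightarrow> \<phi> w \<in> carrier G"
  using hom_in_carrier[OF \<phi>_hom] by (simp add: free_monoid_def)

lemma \<phi>_append: "v \<in> lists A \<Longrightarrow> w \<in> lists A \<Longrightarrow> \<phi> (v @ w) = \<phi> v \<otimes> \<phi> w"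
  using hom_mult[OF \<phi>_hom] by (simp add: free_monoid_def)

lemma \<phi>_factor_eq_cocycle_product:
  assumes "x \<in> X"
  shows "\<phi> (factor x 0 (int n)) = cocycle_product G shift (\<lambda>x. \<phi> [x 0]) n x"
proof (induction n)
  case 0
  show ?case by (simp add: factor_def \<phi>_Nil)
next
  case (Suc n)
  have "\<phi> (factor x 0 (int (Suc n))) = \<phi> (factor x 0 (int n)) \<otimes> \<phi> [x (int n)]"
    unfolding factor_Suc
    using factor_in_lists[OF assms] letter_in_alphabet[OF assms] by (intro \<phi>_append) auto
  with Suc show ?case by (simp add: funpow_shift)
qed

lemma measurable_\<phi>_letter: "(\<lambda>x. \<phi> [x 0]) \<in> measurable \<mu> (count_space (carrier G))"
  by (rule measurable_compose[OF measurable_coordinate]) (simp add: \<phi>_closed)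

lemma measurable_indicator_\<phi>_factor [measurable]:
  "(\<lambda>x. indicator K (\<phi> (factor x 0 (int n))) :: real) \<in> borel_measurable \<mu>"
proof -
  have "cocycle_product G shift (\<lambda>x. \<phi> [x 0]) n \<in> measurable \<mu> (count_space (carrier G))"
    by (rule measurable_cocycle_product[OF monoid_axioms countable_finite[OF finite_carrier]
          measurable_\<phi>_letter])
  from measurable_compose[OF this, of "indicator K" borel] show ?thesis
    by (rule measurable_cong[THEN iffD1, rotated]) (simp_all add: space_eq \<phi>_factor_eq_cocycle_product)
qed

lemma AE_convergent_pointwise_averages: "AE x in \<mu>. convergent (pointwise_averages \<phi> K x)"
  using AE_convergent_cocycle_product_average
    [OF group_axioms finite_carrier measurable_\<phi>_letter, of "indicator K"] AE_space
proof eventually_elim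
  case (elim x)
  then have "pointwise_averages \<phi> K x =
      (\<lambda>n. (\<Sum>i<n. indicator K (cocycle_product G shift (\<lambda>x. \<phi> [x 0]) i x)) / real n)"
    by (simp add: fun_eq_iff pointwise_averages_def space_eq \<phi>_factor_eq_cocycle_product)
  with elim show ?case by simp
qed

lemma measurable_pointwise_averages: "(\<lambda>x. pointwise_averages \<phi> K x n) \<in> borel_measurable \<mu>"
  unfolding pointwise_averages_def by measurable

lemma abs_pointwise_averages_le_1: "\<bar>pointwise_averages \<phi> K x n\<bar> \<le> 1"
proof -
  have "(\<Sum>i<n. indicator K (\<phi> (factor x 0 (int i))) :: real) \<le> real n"
    using sum_bounded_above[of "{..<n}" "\<lambda>i. indicator K (\<phi> (factor x 0 (int i)))" "1 :: real"]
    by (simp add: indicator_le_1)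
  then show ?thesis by (cases "n = 0") (simp_all add: pointwise_averages_def sum_nonneg)
qed

lemma density_averages_eq_integral:
  "density_averages \<mu> (group_language A \<phi> K) n = (\<integral>x. pointwise_averages \<phi> K x n \<partial>\<mu>)"
proof -
  have "measure \<mu> {x \<in> space \<mu>. factor x 0 (int i) \<in> group_language A \<phi> K} =
      (\<integral>x. indicator K (\<phi> (factor x 0 (int i))) \<partial>\<mu>)" for i
  proof -
    let ?V = "{x \<in> space \<mu>. factor x 0 (int i) \<in> group_language A \<phi> K}"
    have "(\<integral>x. indicator K (\<phi> (factor x 0 (int i))) \<partial>\<mu>) = (\<integral>x. indicator ?V x \<partial>\<mu> :: real)"
      by (intro Bochner_Integration.integral_cong)
        (auto simp: space_eq indicator_def group_language_def factor_in_lists)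
    also have "\<dots> = measure \<mu> (?V \<inter> space \<mu>)" by simp
    also have "?V \<inter> space \<mu> = ?V" by blast
    finally show ?thesis ..
  qed
  moreover have "integrable \<mu> (\<lambda>x. indicator K (\<phi> (factor x 0 (int i))) :: real)" for i
    by (rule integrable_const_bound[where B = 1]) auto
  ultimately show ?thesis
    by (simp add: density_averages_def pointwise_averages_def)
qed

lemma integrable_pointwise_density: "integrable \<mu> (pointwise_density \<phi> K)"
  unfolding pointwise_density_def[abs_def]
  by (rule bounded_convergence_lim(1)[OF measurable_pointwise_averages abs_pointwise_averages_le_1
        AE_convergent_pointwise_averages])

lemma density_averages_tendsto:
  "density_averages \<mu> (group_language A \<phi> K) \<longlonglongrightarrow> (\<integral>x. pointwise_density \<phi> K x \<partial>\<mu>)"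
  unfolding density_averages_eq_integral[abs_def] pointwise_density_def
  by (rule bounded_convergence_lim(2)[OF measurable_pointwise_averages abs_pointwise_averages_le_1
        AE_convergent_pointwise_averages])

end

theorem theorem3p12:
  fixes A :: "'a set" and X :: "(int \<Rightarrow> 'a) set" and \<mu> :: "(int \<Rightarrow> 'a) measure"
    and G :: "('g, 'm) monoid_scheme" and \<phi> :: "'a list \<Rightarrow> 'g" and K :: "'g set"
  assumes "shift_space A X"
    and "shift_invariant_prob A X \<mu>"
    and "group G" and "finite (carrier G)"
    and "onto_monoid_morphism A G \<phi>"
    and "K \<subseteq> carrier G"
  shows "(AE x in \<mu>. convergent (pointwise_averages \<phi> K x)) \<and>
    convergent (density_averages \<mu> (group_language A \<phi> K)) \<and>
    integrable \<mu> (pointwise_density \<phi> K) \<and>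
    density_of \<mu> (group_language A \<phi> K) = (\<integral>x. pointwise_density \<phi> K x \<partial>\<mu>)"
proof -
  interpret invariant_shift_space A X \<mu>
    using assms(1,2) by unfold_locales
  interpret group G by fact
  interpret shift_group_morphism A X \<mu> G \<phi>
    using assms(4,5) by unfold_locales (simp_all add: onto_monoid_morphism_def epi_def)
  have "convergent (density_averages \<mu> (group_language A \<phi> K))"
    using density_averages_tendsto by (rule convergentI)
  moreover have "density_of \<mu> (group_language A \<phi> K) = (\<integral>x. pointwise_density \<phi> K x \<partial>\<mu>)"
    unfolding density_of_def using density_averages_tendsto by (rule limI)
  ultimately show ?thesis
    using AE_convergent_pointwise_averages integrable_pointwise_density by blast
qed

end
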